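(* Let $0<\rho<1$, let $N\ge2$ be even, and put $M=N/2$. Then $$\mathbf{B}_N\,\mathbf{T}_N(\rho)\,\mathbf{B}_N^{T}=\begin{pmatrix}\mathbf{T}^{(s)}_M&0\\0&\mathbf{T}^{(a)}_M\end{pmatrix},$$ where the two $M\times M$ blocks satisfy the exact identities $$\mathbf{T}^{(s)}_M=\rho\,\mathbf{L}^{\mathrm{II}}_M+(1-\rho)^2\mathbf{I}_M+\rho(1-\rho)\,e_0e_0^T,\qquad \mathbf{T}^{(a)}_M=\rho\,\mathbf{L}^{\mathrm{IV}}_M+(1-\rho)^2\mathbf{I}_M+\rho(1-\rho)\,e_0e_0^T.$$
   Context: $\mathbf{R}_N(\rho)=[\rho^{|i-j|}]_{i,j=0}^{N-1}$ is the AR(1) covariance matrix and $\mathbf{T}_N(\rho)=(1-\rho^2)\mathbf{R}_N(\rho)^{-1}$. Explicitly, $\mathbf{T}_N(\rho)$ is the symmetric tridiagonal $N\times N$ matrix with diagonal $(1,1+\rho^2,\dots,1+\rho^2,1)$ and all sub- and superdiagonal entries equal to $-\rho$. $\mathbf{I}_M$ is the identity, $\mathbf{J}_M$ the order-reversal (counter-identity) matrix, $e_0=(1,0,\dots,0)^T\in\mathbb{R}^M$, and $\mathbf{B}_N=\frac{1}{\sqrt2}\begin{pmatrix}\mathbf{I}_M&\mathbf{J}_M\\ \mathbf{I}_M&-\mathbf{J}_M\end{pmatrix}$. For $M\ge2$, $\mathbf{L}^{\mathrm{II}}_M$ is the symmetric tridiagonal $M\times M$ matrix with diagonal $(1,2,\dots,2,1)$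 and off-diagonal entries $-1$, and $\mathbf{L}^{\mathrm{IV}}_M$ is the symmetric tridiagonal $M\times M$ matrix with diagonal $(1,2,\dots,2,3)$ and off-diagonal entries $-1$. For $M=1$, $\mathbf{L}^{\mathrm{II}}_1=(0)$ and $\mathbf{L}^{\mathrm{IV}}_1=(2)$. *)

theory Defs
  imports Complex_Main "Jordan_Normal_Form.Determinant"
begin

definition ar1_cov :: "nat \<Rightarrow> real \<Rightarrow> real mat" where
  "ar1_cov N \<rho> = mat N N (\<lambda>(i, j). \<rho> ^ nat \<bar>int i - int j\<bar>)"

(* mat_inverse returns an option; the inverse exists for 0 < \<rho> < 1,
   see ar1_T_explicit below. *)
definition ar1_T :: "nat \<Rightarrow> real \<Rightarrow> real mat" where
  "ar1_T N \<rho> = (1 - \<rho>\<^sup>2) \<cdot>\<^sub>m the (mat_inverse (ar1_cov N \<rho>))"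

definition counter_id :: "nat \<Rightarrow> real mat" where
  "counter_id M = mat M M (\<lambda>(i, j). if i + j + 1 = M then 1 else 0)"

definition e0_col :: "nat \<Rightarrow> real mat" where
  "e0_col M = mat_of_cols M [unit_vec M 0]"

(* Intended for even N. *)
definition butterfly :: "nat \<Rightarrow> real mat" where
  "butterfly N = (let M = N div 2 in
     (1 / sqrt 2) \<cdot>\<^sub>m four_block_mat (1\<^sub>m M) (counter_id M) (1\<^sub>m M) (- counter_id M))"

definition sym_tridiag :: "nat \<Rightarrow> (nat \<Rightarrow> real) \<Rightarrow> real \<Rightarrow> real mat" where
  "sym_tridiag n d c = mat n n (\<lambda>(i, j).
     if i = j then d i else if i = Suc j \<or> j = Suc i then c else 0)"

(* M = 1 is a separate convention, since there the first and the last diagonal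
   entry coincide. *)
definition L_II :: "nat \<Rightarrow> real mat" where
  "L_II M = (if M = 1 then mat 1 1 (\<lambda>_. 0)
     else sym_tridiag M (\<lambda>i. if i = 0 \<or> i = M - 1 then 1 else 2) (- 1))"

definition L_IV :: "nat \<Rightarrow> real mat" where
  "L_IV M = (if M = 1 then mat 1 1 (\<lambda>_. 2)
     else sym_tridiag M (\<lambda>i. if i = 0 then 1 else if i = M - 1 then 3 else 2) (- 1))"

lemma ar1_T_explicit:
  assumes r: "0 < \<rho>" "\<rho> < 1" and N: "N \<ge> 2"
  shows "mat_inverse (ar1_cov N \<rho>) \<noteq> None"
    and "ar1_T N \<rho> = sym_tridiag N (\<lambda>i. if i = 0 \<or> i = N - 1 then 1 else 1 + \<rho>\<^sup>2) (- \<rho>)"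
proof -
  define d where "d i = (if i = 0 \<or> i = N - 1 then 1 else 1 + \<rho>\<^sup>2)" for i
  define P where "P = sym_tridiag N d (- \<rho>)"
  define R where "R = ar1_cov N \<rho>"
  have c: "R \<in> carrier_mat N N" "P \<in> carrier_mat N N"
    by (auto simp: R_def P_def ar1_cov_def sym_tridiag_def)
  have r2: "1 - \<rho>\<^sup>2 \<noteq> 0"
    using r by (simp add: power2_eq_1_iff)
  define f where "f i k = \<rho> ^ nat \<bar>int i - int k\<bar>" for i k :: nat
  have step: "f i (k + 1) = (if i \<le> k then \<rho> * f i k else f i k / \<rho>)" for i k
  proof (cases "i \<le> k")
    case True
    then have "nat \<bar>int i - int (k + 1)\<bar> = Suc (nat \<bar>int i - int k\<bar>)" by auto
    then show ?thesis using True by (simp only: f_def power_Suc if_True)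
  next
    case False
    then have "nat \<bar>int i - int k\<bar> = Suc (nat \<bar>int i - int (k + 1)\<bar>)" by auto
    then show ?thesis using False r by (simp only: f_def power_Suc) simp
  qed
  have ent: "(R * P) $$ (i, j) = (if i = j then 1 - \<rho>\<^sup>2 else 0)" if ij: "i < N" "j < N" for i j
  proof -
    have "(R * P) $$ (i, j) = (\<Sum>k = 0..<N. R $$ (i, k) * P $$ (k, j))"
      using ij c by (simp add: scalar_prod_def)
    also have "\<dots> = (\<Sum>k = 0..<N. (if k = j then f i k * d k else 0)
        + (if k = j + 1 then - \<rho> * f i k else 0) + (if j \<noteq> 0 \<and> k = j - 1 then - \<rho> * f i k else 0))"
      using ij by (intro sum.cong) (auto simp: R_def P_def ar1_cov_def sym_tridiag_def f_def)
    also have "\<dots> = f i j * d j + (if j + 1 < N then - \<rho> * f i (j + 1) else 0)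
        + (if j \<noteq> 0 then - \<rho> * f i (j - 1) else 0)"
      using ij by (cases "j = 0") (simp_all add: sum.distrib)
    also have "\<dots> = (if i = j then 1 - \<rho>\<^sup>2 else 0)"
    proof (cases j)
      case 0
      have "f i 0 = 1" if "i = 0" using that by (simp add: f_def)
      then show ?thesis using 0 N r step[of i 0]
        by (auto simp: d_def power2_eq_square)
    next
      case (Suc m)
      have a: "f i (m + 1) = (if i \<le> m then \<rho> * f i m else f i m / \<rho>)" by (rule step)
      have b: "f i (m + 1 + 1) = (if i \<le> m + 1 then \<rho> * f i (m + 1) else f i (m + 1) / \<rho>)" by (rule step)
      have e: "f i (m + 1) = 1" if "i = m + 1" using that by (simp add: f_def)
      have dj: "d j = (if m + 1 + 1 < N then 1 + \<rho>\<^sup>2 else 1)"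
        using Suc ij by (auto simp: d_def)
      consider "i \<le> m" | "i = m + 1" | "i > m + 1" by linarith
      then show ?thesis
      proof cases
        case 1
        then show ?thesis using Suc a b dj r
          by (auto simp: field_simps power2_eq_square)
      next
        case 2
        then have "f i m = \<rho>" using a e r by (simp add: field_simps)
        then show ?thesis using Suc 2 a b e dj r
          by (auto simp: field_simps power2_eq_square)
      next
        case 3
        then show ?thesis using Suc a b dj r ij
          by (auto simp: field_simps power2_eq_square)
      qed
    qed
    finally show ?thesis .
  qed
  define Q where "Q = (1 / (1 - \<rho>\<^sup>2)) \<cdot>\<^sub>m P"
  have Qc: "Q \<in> carrier_mat N N" using c by (simp add: Q_def)
  have RQ: "R * Q = 1\<^sub>m N"
  proof (rule eq_matI)
    fix i j assume "i < dim_row (1\<^sub>m N :: real mat)" "j < dim_col (1\<^sub>m N :: real mat)"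
    then have "i < N" "j < N" by auto
    then show "(R * Q) $$ (i, j) = 1\<^sub>m N $$ (i, j)"
      using ent[of i j] c r2 unfolding Q_def mult_smult_distrib[OF c] by simp
  qed (use c Qc in auto)
  have QR: "Q * R = 1\<^sub>m N"
    by (rule mat_mult_left_right_inverse[OF c(1) Qc RQ])
  have U: "R \<in> Units (ring_mat TYPE(real) N ())"
    using c Qc RQ QR by (auto simp: Units_def ring_mat_def)
  then show ne: "mat_inverse (ar1_cov N \<rho>) \<noteq> None"
    using mat_inverse(1)[OF c(1), of "()"] unfolding R_def by blast
  then obtain B where B: "mat_inverse R = Some B" unfolding R_def by blast
  then have BR: "B * R = 1\<^sub>m N" "B \<in> carrier_mat N N"
    using mat_inverse(2)[OF c(1)] by auto
  have "B = B * (R * Q)" using RQ BR by simp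
  also have "\<dots> = Q" using BR c Qc by (simp flip: assoc_mult_mat)
  finally have "ar1_T N \<rho> = P"
    using B r2 c by (auto simp: ar1_T_def R_def Q_def)
  then show "ar1_T N \<rho> = sym_tridiag N (\<lambda>i. if i = 0 \<or> i = N - 1 then 1 else 1 + \<rho>\<^sup>2) (- \<rho>)"
    by (simp add: P_def d_def[abs_def])
qed

end

theory Submission
  imports Defs
begin

text \<open>Cut into \<open>M \<times> M\<close> blocks, the tridiagonal matrix is centrosymmetric, of the form
  \<open>(A, C; J C J, J A J)\<close>. The butterfly block-diagonalises every such block matrix, with diagonal
  blocks \<open>A + C J\<close> and \<open>A - C J\<close>. Here \<open>C J\<close> has the single nonzero entry \<open>- \<rho>\<close>, in the
  bottom right corner, so the two blocks differ from \<open>A\<close> in the last diagonal entry only.\<close>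

lemma counter_id_carrier [simp]: "counter_id M \<in> carrier_mat M M"
  by (simp add: counter_id_def)

lemma dim_counter_id [simp]: "dim_row (counter_id M) = M" "dim_col (counter_id M) = M"
  by (simp_all add: counter_id_def)

lemma transpose_counter_id [simp]: "transpose_mat (counter_id M) = counter_id M"
  by (rule eq_matI) (auto simp: counter_id_def add.commute)

lemma counter_id_mult_index:
  assumes "X \<in> carrier_mat M n" "i < M" "j < n"
  shows "(counter_id M * X) $$ (i, j) = X $$ (M - 1 - i, j)"
proof -
  have "(counter_id M * X) $$ (i, j) = (\<Sum>k = 0..<M. counter_id M $$ (i, k) * X $$ (k, j))"
    using assms by (simp add: scalar_prod_def)
  \<comment> \<open>The condition \<open>i + k + 1 = M\<close> leaves the single index
    \<open>k = M - 1 - i\<close>; the subtraction does not truncate because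
    \<open>i < M\<close>.\<close>
  also have "\<dots> = (\<Sum>k = 0..<M. if k = M - 1 - i then X $$ (k, j) else 0)"
    using assms by (intro sum.cong) (auto simp: counter_id_def)
  finally show ?thesis using assms by simp
qed

lemma mult_counter_id_index:
  assumes "X \<in> carrier_mat n M" "i < n" "j < M"
  shows "(X * counter_id M) $$ (i, j) = X $$ (i, M - 1 - j)"
proof -
  have "(X * counter_id M) $$ (i, j) = (\<Sum>k = 0..<M. X $$ (i, k) * counter_id M $$ (k, j))"
    using assms by (simp add: scalar_prod_def)
  also have "\<dots> = (\<Sum>k = 0..<M. if k = M - 1 - j then X $$ (i, k) else 0)"
    using assms by (intro sum.cong) (auto simp: counter_id_def)
  finally show ?thesis using assms by simp
qed

lemma counter_id_square: "counter_id M * counter_id M = 1\<^sub>m M"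
  by (rule eq_matI)
    (auto simp: counter_id_mult_index[of _ _ M] simp del: index_mult_mat(1), auto simp: counter_id_def)

text \<open>In right-nested products the square of the reversal is no longer a subterm; this is the
  shape in which it has to cancel.\<close>

lemma counter_id_cancel:
  assumes "X \<in> carrier_mat M n"
  shows "counter_id M * (counter_id M * X) = X"
  using assms by (simp add: counter_id_square flip: assoc_mult_mat[of _ M M _ M _ n])

text \<open>As \<open>J * J\<close> is the identity, the left factor turns the block rows into
  \<open>(S, S * J)\<close> and \<open>(D, - D * J)\<close> with \<open>S = A + C * J\<close> and
  \<open>D = A - C * J\<close>. The right factor adds to, or subtracts from, the first block column
  the second one times \<open>J\<close>, so each block doubles or vanishes.\<close>

lemma butterfly_conj_centrosymmetric:
  fixes A C :: "real mat"
  assumes A: "A \<in> carrier_mat M M" and C: "C \<in> carrier_mat M M"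
  defines "J \<equiv> counter_id M"
  shows "butterfly (2 * M) * four_block_mat A C (J * C * J) (J * A * J) * transpose_mat (butterfly (2 * M))
    = four_block_mat (A + C * J) (0\<^sub>m M M) (0\<^sub>m M M) (A - C * J)"
proof -
  define T where "T = four_block_mat A C (J * C * J) (J * A * J)"
  \<comment> \<open>The butterfly without its factor \<open>1 / sqrt 2\<close>, so that the block
    computation is free of square roots.\<close>
  define K where "K = four_block_mat (1\<^sub>m M) J (1\<^sub>m M) (- J)"
  have J: "J \<in> carrier_mat M M" "- J \<in> carrier_mat M M" by (simp_all add: J_def)
  have JX: "J * X * J \<in> carrier_mat M M" "X * J \<in> carrier_mat M M" if "X \<in> carrier_mat M M" for X
    using that J by auto
  have Tc: "T \<in> carrier_mat (M + M) (M + M)" and Kc: "K \<in> carrier_mat (M + M) (M + M)"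
    using A C J by (auto simp: T_def K_def)
  have JJ: "J * (J * X) = X" if "X \<in> carrier_mat M M" for X
    using that by (simp add: J_def counter_id_cancel)
  have uJ: "- J * X = - (J * X)" "X * - J = - (X * J)" if "X \<in> carrier_mat M M" for X
    using that J by auto
  have JJ1: "J * J = 1\<^sub>m M"
    by (simp add: J_def counter_id_square)
  have KT: "K * T = four_block_mat (A + C * J) (C + A * J) (A - C * J) (C - A * J)"
    unfolding K_def T_def
    using A C J JX[OF A] JX[OF C]
    by (subst mult_four_block_mat[of _ M M _ M _ M _ _ M _ M])
      (simp_all add: JJ uJ, auto intro!: cong_four_block_mat eq_matI simp del: index_mult_mat(1))
  have Kt: "transpose_mat K = four_block_mat (1\<^sub>m M) (1\<^sub>m M) J (- J)"
    unfolding K_def using J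
    by (subst transpose_four_block_mat[of _ M M _ M _ M])
      (auto simp: transpose_uminus J_def)
  have blk: "(C + A * J) * J = C * J + A" "(C - A * J) * J = C * J - A"
    using A C J JX[OF A] JX[OF C]
    by (simp_all add: add_mult_distrib_mat[of _ M M] minus_mult_distrib_mat[of _ M M] JJ1)
  have KTK: "K * T * transpose_mat K
      = four_block_mat (2 \<cdot>\<^sub>m (A + C * J)) (0\<^sub>m M M) (0\<^sub>m M M) (2 \<cdot>\<^sub>m (A - C * J))"
    unfolding KT Kt
    using A C J JX[OF A] JX[OF C]
    by (subst mult_four_block_mat[of _ M M _ M _ M _ _ M _ M])
      (simp_all add: uJ blk, auto intro!: cong_four_block_mat eq_matI simp del: index_mult_mat(1))
  have B: "butterfly (2 * M) = (1 / sqrt 2) \<cdot>\<^sub>m K"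
    by (simp add: butterfly_def Let_def K_def J_def)
  \<comment> \<open>The two factors \<open>1 / sqrt 2\<close> combine to \<open>1/2\<close>, which
    cancels the 2 in \<open>KTK\<close>.\<close>
  have "butterfly (2 * M) * T * transpose_mat (butterfly (2 * M)) = (1/2) \<cdot>\<^sub>m (K * T * transpose_mat K)"
  proof -
    have "transpose_mat ((1 / sqrt 2) \<cdot>\<^sub>m K) = (1 / sqrt 2) \<cdot>\<^sub>m transpose_mat K"
      by (rule eq_matI) auto
    moreover have "transpose_mat K \<in> carrier_mat (M + M) (M + M)" "K * T \<in> carrier_mat (M + M) (M + M)"
      using Kc Tc by auto
    ultimately show ?thesis
      unfolding B using Tc Kc
      by (simp add: mult_smult_assoc_mat[of _ "M + M" "M + M" _ "M + M"]
          mult_smult_distrib[of _ "M + M" "M + M" _ "M + M"] del: assoc_mult_mat) (auto intro!: eq_matI simp del: index_mult_mat(1))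
  qed
  then show ?thesis
    unfolding KTK T_def[symmetric] using A C J JX[OF A] JX[OF C]
    by (auto intro!: eq_matI)
qed

lemma e0_col_outer:
  "e0_col M * transpose_mat (e0_col M) = mat M M (\<lambda>(i, j). if i = 0 \<and> j = 0 then 1 else 0)"
  by (rule eq_matI) (auto simp: e0_col_def scalar_prod_def mat_of_cols_def)

theorem lemma4p1:
  fixes \<rho> :: real and N M :: nat
  assumes "0 < \<rho>" and "\<rho> < 1"
    and "N \<ge> 2" and "even N" and "M = N div 2"
  shows "\<exists>T_s \<in> carrier_mat M M. \<exists>T_a \<in> carrier_mat M M.
    butterfly N * ar1_T N \<rho> * transpose_mat (butterfly N)
      = four_block_mat T_s (0\<^sub>m M M) (0\<^sub>m M M) T_a
    \<and> T_s = \<rho> \<cdot>\<^sub>m L_II M + (1 - \<rho>)\<^sup>2 \<cdot>\<^sub>m 1\<^sub>m M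
          + (\<rho> * (1 - \<rho>)) \<cdot>\<^sub>m (e0_col M * transpose_mat (e0_col M))
    \<and> T_a = \<rho> \<cdot>\<^sub>m L_IV M + (1 - \<rho>)\<^sup>2 \<cdot>\<^sub>m 1\<^sub>m M
          + (\<rho> * (1 - \<rho>)) \<cdot>\<^sub>m (e0_col M * transpose_mat (e0_col M))"
proof -
  have N: "N = 2 * M" and M: "M \<ge> 1" using assms by auto
  define J where "J = counter_id M"
  \<comment> \<open>The upper blocks of the tridiagonal matrix. Its last row lies outside
    \<open>A\<close>, so only index 0 gets the diagonal entry 1, also for \<open>M = 1\<close>. The
    halves are coupled only through the neighbours \<open>M - 1\<close> and \<open>M\<close>, which
    is the one entry of \<open>C\<close>.\<close>
  define A where "A = sym_tridiag M (\<lambda>i. if i = 0 then 1 else 1 + \<rho>\<^sup>2) (- \<rho>)"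
  define C where "C = mat M M (\<lambda>(i, j). if i = M - 1 \<and> j = 0 then - \<rho> else 0)"
  have A: "A \<in> carrier_mat M M" and C: "C \<in> carrier_mat M M" and J: "J \<in> carrier_mat M M"
    by (simp_all add: A_def C_def J_def sym_tridiag_def)
  have flip: "(J * X * J) $$ (i, j) = X $$ (M - 1 - i, M - 1 - j)"
    if "X \<in> carrier_mat M M" "i < M" "j < M" for X i j
    using that J counter_id_mult_index[of X M M i "M - 1 - j"]
      mult_counter_id_index[of "J * X" M M i j]
    by (simp add: J_def mult_carrier_mat[of _ M M] del: index_mult_mat(1) assoc_mult_mat)
  have CJ: "C * J = mat M M (\<lambda>(i, j). if i = M - 1 \<and> j = M - 1 then - \<rho> else 0)"
    by (rule eq_matI) (use C in \<open>auto simp: J_def mult_counter_id_index[of _ M M]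
      simp del: index_mult_mat(1)\<close>, auto simp: C_def)
  have "ar1_T N \<rho> = four_block_mat A C (J * C * J) (J * A * J)"
    unfolding ar1_T_explicit(2)[OF assms(1-3)]
  \<comment> \<open>For an index \<open>i\<close> of the lower half, \<open>flip\<close> reads
    position \<open>M - 1 - (i - M) = N - 1 - i\<close>; thus the corner entry 1 of \<open>A\<close>
    reappears at \<open>N - 1\<close>.\<close>
  proof (rule eq_matI, goal_cases)
    case (1 i j)
    then have "i < 2 * M" "j < 2 * M" using A J by auto
    then show ?case using A C J M
      by (auto simp: N flip simp del: index_mult_mat(1) assoc_mult_mat)
        (auto simp: sym_tridiag_def A_def C_def)
  qed (use A J in \<open>auto simp: N sym_tridiag_def\<close>)
  then have *: "butterfly N * ar1_T N \<rho> * transpose_mat (butterfly N)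
      = four_block_mat (A + C * J) (0\<^sub>m M M) (0\<^sub>m M M) (A - C * J)"
    using butterfly_conj_centrosymmetric[OF A C] by (simp add: N J_def)
  \<comment> \<open>On the diagonal:
    \<open>\<rho> + (1 - \<rho>)\<^sup>2 + \<rho> * (1 - \<rho>) = 1\<close> at index 0,
    \<open>2 * \<rho> + (1 - \<rho>)\<^sup>2 = 1 + \<rho>\<^sup>2\<close> inside, and
    \<open>\<rho> + (1 - \<rho>)\<^sup>2 = 1 + \<rho>\<^sup>2 - \<rho>\<close> at the end. For
    \<open>M = 1\<close> the ends coincide and the entry is \<open>1 - \<rho>\<close>.\<close>
  have s: "A + C * J = \<rho> \<cdot>\<^sub>m L_II M + (1 - \<rho>)\<^sup>2 \<cdot>\<^sub>m 1\<^sub>m M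
          + (\<rho> * (1 - \<rho>)) \<cdot>\<^sub>m (e0_col M * transpose_mat (e0_col M))"
    unfolding CJ e0_col_outer A_def L_II_def sym_tridiag_def
    by (rule eq_matI) (auto simp: power2_eq_square algebra_simps)
  \<comment> \<open>Now the last entry is \<open>1 + \<rho>\<^sup>2 + \<rho> = 3 * \<rho> + (1 -
    \<rho>)\<^sup>2\<close>, whence the 3 in \<open>L_IV\<close>; for \<open>M = 1\<close> it is
    \<open>1 + \<rho>\<close>.\<close>
  have a: "A - C * J = \<rho> \<cdot>\<^sub>m L_IV M + (1 - \<rho>)\<^sup>2 \<cdot>\<^sub>m 1\<^sub>m M
          + (\<rho> * (1 - \<rho>)) \<cdot>\<^sub>m (e0_col M * transpose_mat (e0_col M))"
    unfolding CJ e0_col_outer A_def L_IV_def sym_tridiag_def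
    by (rule eq_matI) (auto simp: power2_eq_square algebra_simps)
  show ?thesis
    using A C J by (intro bexI[of _ "A + C * J"] bexI[of _ "A - C * J"] conjI * s a) auto
qed

end
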